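(* Let $\mathbb{T}$ be the real vector space $\mathbb{R}^3$ with basis $\mathbf{1}_{\mathbb{T}}=(1,0,0)$, $\mathbf{u}=(0,1,0)$, $\mathbf{v}=(0,0,1)$, equipped with the multiplication $$(X_1,X_u,X_v)\otimes(Y_1,Y_u,Y_v)=\big(X_1Y_1-X_uY_v-X_vY_u,\; X_1Y_u+X_uY_1-X_vY_v,\; X_1Y_v+X_uY_u+X_vY_1\big).$$ Then $\mathbb{T}$ is a three-dimensional unital associative and commutative algebra over the field $\mathbb{R}$.
   Context: An algebra over a field $\mathbb{K}$ is a vector space $A$ over $\mathbb{K}$ together with a bilinear associative multiplication: for all $a,b,c\in A$ and $\lambda\in\mathbb{K}$, $a(b+c)=ab+ac$, $(b+c)a=ba+ca$, $(ab)c=a(bc)$, $(\lambda a)b=a(\lambda b)=\lambda(ab)$. It is commutative if the multiplication is commutative, and unital if it has an identity element for the multiplication. *)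

theory Defs
  imports "HOL-Analysis.Analysis"
begin

locale algebra_over_field = vector_space scale
  for scale :: "'k::field \<Rightarrow> 'a::ab_group_add \<Rightarrow> 'a" +
  fixes mul :: "'a \<Rightarrow> 'a \<Rightarrow> 'a"
  assumes mult_add_right: "mul a (b + c) = mul a b + mul a c"
    and mult_add_left: "mul (b + c) a = mul b a + mul c a"
    and mult_assoc: "mul (mul a b) c = mul a (mul b c)"
    and mult_scale_left: "mul (scale r a) b = scale r (mul a b)"
    and mult_scale_right: "mul a (scale r b) = scale r (mul a b)"

locale commutative_algebra_over_field = algebra_over_field +
  assumes mult_commute: "mul a b = mul b a"

definition is_identity :: "('a \<Rightarrow> 'a \<Rightarrow> 'a) \<Rightarrow> 'a \<Rightarrow> bool"
  where "is_identity mul e \<longleftrightarrow> (\<forall>a. mul e a = a \<and> mul a e = a)"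

locale unital_algebra_over_field = algebra_over_field +
  assumes ex_identity: "\<exists>e. is_identity mul e"

definition T_one :: "real^3" where "T_one = vector [1, 0, 0]"
definition T_u :: "real^3" where "T_u = vector [0, 1, 0]"
definition T_v :: "real^3" where "T_v = vector [0, 0, 1]"

(* A dedicated symbol is needed because the library's * on real^3 is componentwise. *)
definition T_mult :: "real^3 \<Rightarrow> real^3 \<Rightarrow> real^3"  (infixl "\<otimes>\<^sub>T" 70)
  where "X \<otimes>\<^sub>T Y = vector
    [X$1 * Y$1 - X$2 * Y$3 - X$3 * Y$2,
     X$1 * Y$2 + X$2 * Y$1 - X$3 * Y$3,
     X$1 * Y$3 + X$2 * Y$2 + X$3 * Y$1]"

end

theory Submission
  imports Defs
begin

text \<open>Reducing products of polynomials in u by the relation u^3 = -1 gives exactly the formula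
  for the product, which explains why the ring laws hold. The proof verifies them directly: by
  \<open>T_mult_nth\<close> each law becomes three polynomial identities in real coordinates. The
  linear part rests on \<open>T_basis_eq_Basis\<close>.\<close>

text \<open>Since \<open>u\<^sup>2 = v\<close> and \<open>u\<^sup>3 = -1\<close>, the algebra is \<open>\<real>[u] / (u\<^sup>3 + 1)\<close> in the basis \<open>1, u, u\<^sup>2\<close>.\<close>

lemma T_one_nth [simp]: "T_one $ 1 = 1" "T_one $ 2 = 0" "T_one $ 3 = 0"
  by (simp_all add: T_one_def)

lemma T_u_nth [simp]: "T_u $ 1 = 0" "T_u $ 2 = 1" "T_u $ 3 = 0"
  by (simp_all add: T_u_def)

lemma T_v_nth [simp]: "T_v $ 1 = 0" "T_v $ 2 = 0" "T_v $ 3 = 1"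
  by (simp_all add: T_v_def)

lemma T_mult_nth [simp]:
  "(X \<otimes>\<^sub>T Y) $ 1 = X$1 * Y$1 - X$2 * Y$3 - X$3 * Y$2"
  "(X \<otimes>\<^sub>T Y) $ 2 = X$1 * Y$2 + X$2 * Y$1 - X$3 * Y$3"
  "(X \<otimes>\<^sub>T Y) $ 3 = X$1 * Y$3 + X$2 * Y$2 + X$3 * Y$1"
  by (simp_all add: T_mult_def)

text \<open>Independence is stated for a set, where repeated vectors would collapse unnoticed; this
  rules that out.\<close>

lemma T_basis_distinct: "distinct [T_one, T_u, T_v]"
  by (simp add: vec_eq_iff forall_3)

text \<open>Identifies the three vectors with the Euclidean basis, so that independence and spanning
  are inherited from \<open>Basis\<close>.\<close>

lemma T_basis_eq_Basis: "{T_one, T_u, T_v} = Basis"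
proof -
  have "T_one = axis 1 1" "T_u = axis 2 1" "T_v = axis 3 1"
    by (simp_all add: vec_eq_iff forall_3 axis_def)
  then show ?thesis
    by (auto simp: Basis_vec_def UNIV_3)
qed

lemma T_algebra: "algebra_over_field (scaleR :: real \<Rightarrow> real^3 \<Rightarrow> real^3) (\<otimes>\<^sub>T)"
  \<comment> \<open>Associativity is the only cubic law: in each coordinate both sides expand to the
    same sum of signed monomials.\<close>
  by unfold_locales (simp_all add: vec_eq_iff forall_3 algebra_simps)

lemma T_mult_commute: "X \<otimes>\<^sub>T Y = Y \<otimes>\<^sub>T X"
  by (simp add: vec_eq_iff forall_3 algebra_simps)

lemma T_one_is_identity: "is_identity (\<otimes>\<^sub>T) T_one"
  by (simp add: is_identity_def vec_eq_iff forall_3)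

theorem theorem1:
  shows "distinct [T_one, T_u, T_v] \<and> independent {T_one, T_u, T_v} \<and> span {T_one, T_u, T_v} = UNIV
    \<and> dim (UNIV :: (real^3) set) = 3
    \<and> algebra_over_field (scaleR :: real \<Rightarrow> real^3 \<Rightarrow> real^3) (\<otimes>\<^sub>T)
    \<and> unital_algebra_over_field (scaleR :: real \<Rightarrow> real^3 \<Rightarrow> real^3) (\<otimes>\<^sub>T)
    \<and> is_identity (\<otimes>\<^sub>T) T_one
    \<and> commutative_algebra_over_field (scaleR :: real \<Rightarrow> real^3 \<Rightarrow> real^3) (\<otimes>\<^sub>T)"
proof (intro conjI)
  show "distinct [T_one, T_u, T_v]"
    by (rule T_basis_distinct)
  show "independent {T_one, T_u, T_v}" "span {T_one, T_u, T_v} = UNIV"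
    unfolding T_basis_eq_Basis by (rule independent_Basis, rule span_Basis)
  show "dim (UNIV :: (real^3) set) = 3"
    by simp
  show "algebra_over_field (scaleR :: real \<Rightarrow> real^3 \<Rightarrow> real^3) (\<otimes>\<^sub>T)"
    by (rule T_algebra)
  show "is_identity (\<otimes>\<^sub>T) T_one"
    by (rule T_one_is_identity)
  \<comment> \<open>\<open>T_one\<close> is the witness for the existential.\<close>
  then show "unital_algebra_over_field (scaleR :: real \<Rightarrow> real^3 \<Rightarrow> real^3) (\<otimes>\<^sub>T)"
    by (intro unital_algebra_over_field.intro T_algebra unital_algebra_over_field_axioms.intro exI)
  show "commutative_algebra_over_field (scaleR :: real \<Rightarrow> real^3 \<Rightarrow> real^3) (\<otimes>\<^sub>T)"
    by (intro commutative_algebra_over_field.intro T_algebra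
        commutative_algebra_over_field_axioms.intro T_mult_commute)
qed

end
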